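(* There exists $s\in\mathcal S$ such that $s$ does not induce a homeomorphism (i.e. there is no orientation-preserving homeomorphism $h$ of $\mathbb T$ fixing $-1,\mathrm i,1$ with $s_h=s$). Conversely, there exists a quasisymmetric circle homeomorphism $h\in\mathrm{QS}(\mathbb T)$ such that its shear coordinate satisfies $s_h\notin\mathcal S$.
   Context: The Farey tessellation $\mathfrak F$ is the ideal triangulation of the unit disk $\mathbb D$ (hyperbolic metric) obtained from the ideal triangle with vertices $1,\mathrm i,-1$ by repeated hyperbolic reflections across edges; $V\subset\mathbb T=\partial\mathbb D$ is its vertex set, $E$ its set of edges. For $e=(a,c)\in E$, let $a,b,c,d$ be, in counterclockwise order, the vertices of the quad formed by the two triangles of $\mathfrak F$ containing $e$. For an orientation-preserving homeomorphism $h$ of $\mathbb T$ fixing $-1,\mathrm i,1$, its shear coordinate is $s_h:E\to\mathbb R$, $s_h(e)=\log\mathrm{cr}(h(a),h(b),h(c),h(d))$ with $\mathrm{cr}(a,b,c,d)=\frac{(b-a)(d-c)}{(c-b)(d-a)}$. $\mathcal S=\{s:E\to\mathbb R:\sum_{e\in E}s(e)^2<\infty\}$. *)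

theory Defs
  imports "HOL-Analysis.Analysis"
begin

text \<open>The unit circle is \<^term>\<open>sphere (0::complex) 1\<close>. An ideal triangle of the disk is
  represented by the set of its three ideal vertices, a geodesic by the set of its two endpoints.\<close>

text \<open>Hyperbolic reflection of the disk across the geodesic with endpoints \<open>a \<noteq> c\<close> on the circle.
  That geodesic lies on the circle with centre \<open>p = 2ac/(a+c)\<close> orthogonal to the unit circle, or,
  if \<open>c = -a\<close>, on a diameter; the formula below covers both cases, see the two lemmas.\<close>

definition hyp_reflection :: "complex \<Rightarrow> complex \<Rightarrow> complex \<Rightarrow> complex" where
  "hyp_reflection a c z = (2 * a * c * cnj z - (a + c)) / ((a + c) * cnj z - 2)"

lemma hyp_reflection_inversion:
  assumes "norm a = 1" "norm c = 1" "a + c \<noteq> 0" and p: "p = 2 * a * c / (a + c)" and "z \<noteq> p"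
  shows "hyp_reflection a c z = p + of_real ((norm p)\<^sup>2 - 1) / cnj (z - p)"
proof -
  have a: "a * cnj a = 1" and c: "c * cnj c = 1"
    using assms(1,2) by (simp_all add: complex_norm_square[symmetric])
  have ne: "a \<noteq> 0" "c \<noteq> 0" using assms(1,2) by auto
  have ca: "cnj a = 1 / a" and cc: "cnj c = 1 / c" using a c ne by (simp_all add: field_simps)
  have "cnj p = 2 * (1 / a) * (1 / c) / (1 / a + 1 / c)"
    unfolding p complex_cnj_divide complex_cnj_mult complex_cnj_add ca cc by simp
  also have "1 / a + 1 / c = (a + c) / (a * c)" using ne by (simp add: field_simps)
  also have "2 * (1 / a) * (1 / c) / ((a + c) / (a * c)) = 2 / (a + c)"
    using ne by simp
  finally have cp: "cnj p = 2 / (a + c)" .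
  have n: "of_real ((norm p)\<^sup>2 - 1) = p * cnj p - 1"
    using complex_norm_square[of p] by simp
  have d: "cnj z - cnj p \<noteq> 0" using \<open>z \<noteq> p\<close> by (simp flip: complex_cnj_diff)
  have d': "(a + c) * cnj z - 2 = (a + c) * (cnj z - cnj p)"
    using assms(3) by (simp add: cp field_simps)
  have "2 * a * c * cnj z - (a + c) = (a + c) * (p * cnj z - 1)"
    using assms(3) by (simp add: p field_simps)
  then have "hyp_reflection a c z = (p * cnj z - 1) / (cnj z - cnj p)"
    unfolding hyp_reflection_def d' using assms(3) by simp
  also have "\<dots> = p + (p * cnj p - 1) / (cnj z - cnj p)"
    using d by (simp add: field_simps)
  finally show ?thesis unfolding n by simp
qed

lemma hyp_reflection_diameter: "hyp_reflection a (- a) z = a\<^sup>2 * cnj z"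
  by (simp add: hyp_reflection_def power2_eq_square)

inductive_set farey_triangles :: "complex set set" where
  base: "{1, \<i>, - 1} \<in> farey_triangles"
| reflect: "t \<in> farey_triangles \<Longrightarrow> a \<in> t \<Longrightarrow> c \<in> t \<Longrightarrow> a \<noteq> c \<Longrightarrow>
    hyp_reflection a c ` t \<in> farey_triangles"

definition farey_edges :: "complex set set" where
  "farey_edges = {{a, c} | a c. a \<noteq> c \<and> (\<exists>t \<in> farey_triangles. a \<in> t \<and> c \<in> t)}"

definition ccw :: "complex \<Rightarrow> complex \<Rightarrow> complex \<Rightarrow> complex \<Rightarrow> bool" where
  "ccw a b c d \<longleftrightarrow> (\<exists>\<alpha> \<beta> \<gamma> \<delta>. \<alpha> < \<beta> \<and> \<beta> < \<gamma> \<and> \<gamma> < \<delta> \<and> \<delta> < \<alpha> + 2 * pi \<and>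
     a = cis \<alpha> \<and> b = cis \<beta> \<and> c = cis \<gamma> \<and> d = cis \<delta>)"

text \<open>The quad around the edge \<open>{a, c}\<close>.\<close>

definition farey_quad :: "complex \<Rightarrow> complex \<Rightarrow> complex \<Rightarrow> complex \<Rightarrow> bool" where
  "farey_quad a b c d \<longleftrightarrow>
     ccw a b c d \<and> {a, b, c} \<in> farey_triangles \<and> {a, c, d} \<in> farey_triangles"

definition cr :: "complex \<Rightarrow> complex \<Rightarrow> complex \<Rightarrow> complex \<Rightarrow> complex" where
  "cr a b c d = ((b - a) * (d - c)) / ((c - b) * (d - a))"

text \<open>The quad of an edge is unique up to exchanging \<open>(a, b, c, d)\<close> with \<open>(c, d, a, b)\<close>, which does
  not change the cross ratio. For counterclockwise arguments on the circle the cross ratio is a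
  positive real, so \<open>Re\<close> is only a coercion. Values at sets that are not edges are irrelevant.\<close>

definition shear :: "(complex \<Rightarrow> complex) \<Rightarrow> complex set \<Rightarrow> real" where
  "shear h e = (THE x. \<exists>a b c d. e = {a, c} \<and> farey_quad a b c d \<and>
                        x = ln (Re (cr (h a) (h b) (h c) (h d))))"

text \<open>Orientation is expressed through an increasing lift to the universal cover of the circle.
  Only the values of \<open>h\<close> on the circle matter.\<close>

definition orientation_preserving_circle_homeo :: "(complex \<Rightarrow> complex) \<Rightarrow> bool" where
  "orientation_preserving_circle_homeo h \<longleftrightarrow>
     (\<exists>g. homeomorphism (sphere 0 1) (sphere 0 1) h g) \<and>
     (\<exists>f::real \<Rightarrow> real. continuous_on UNIV f \<and> strict_mono f \<and> (\<forall>x. h (cis x) = cis (f x)))"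

definition normalized_circle_homeo :: "(complex \<Rightarrow> complex) \<Rightarrow> bool" where
  "normalized_circle_homeo h \<longleftrightarrow>
     orientation_preserving_circle_homeo h \<and> h (- 1) = - 1 \<and> h \<i> = \<i> \<and> h 1 = 1"

definition quasisymmetric :: "(complex \<Rightarrow> complex) \<Rightarrow> bool" where
  "quasisymmetric h \<longleftrightarrow> orientation_preserving_circle_homeo h \<and>
     (\<exists>C\<ge>1. \<forall>\<theta> t. 0 < t \<and> t < pi \<longrightarrow>
        (let q = norm (h (cis (\<theta> + t)) - h (cis \<theta>)) / norm (h (cis \<theta>) - h (cis (\<theta> - t)))
         in 1 / C \<le> q \<and> q \<le> C))"

text \<open>Functions on the edge set are total functions whose values off the edges are ignored.\<close>

definition square_summable :: "(complex set \<Rightarrow> real) set" where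
  "square_summable = {s. (\<lambda>e. (s e)\<^sup>2) summable_on farey_edges}"

end

theory Submission
  imports Defs "HOL-Real_Asymp.Real_Asymp"
begin

text \<open>In the upper half plane, the edges ending at infinity are the vertical lines over the integers.
  If \<open>h\<close> fixes infinity, its shear on the line over \<open>n\<close> is the logarithm of
  \<open>(h (n + 1) - h n) / (h n - h (n - 1))\<close>. Prescribing these ratios as \<open>(n / (n + 1))\<^sup>2\<close>, and shear
  \<open>0\<close> on all other edges, is square summable but forces \<open>h n\<close> to stay bounded, so \<open>h\<close> is
  not continuous at infinity. Conversely, a bi-Lipschitz homeomorphism of the line that is a bounded
  perturbation of the identity is bi-Lipschitz on the circle, hence quasisymmetric; a periodic
  perturbation yields the same nonzero shear on infinitely many of the vertical lines.\<close>

section \<open>Homogeneous coordinates and the Cayley transform\<close>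

text \<open>The image of the projective point \<open>p : q\<close> under the Cayley transform
  \<open>x \<mapsto> (1 + i x) / (1 - i x)\<close>. Homogeneous coordinates treat infinity, which
  goes to -1, like any other vertex, and let reflections act by matrices.\<close>

definition ideal_point :: "real \<Rightarrow> real \<Rightarrow> complex" where
  "ideal_point p q = Complex q p / Complex q (- p)"

definition cayley :: "real \<Rightarrow> complex" where
  "cayley x = ideal_point x 1"

lemma ideal_point_eq_iff:
  assumes "p \<noteq> 0 \<or> q \<noteq> 0" "r \<noteq> 0 \<or> s \<noteq> 0"
  shows "ideal_point p q = ideal_point r s \<longleftrightarrow> p * s = r * q"
proof -
  have "Complex q (- p) \<noteq> 0" "Complex s (- r) \<noteq> 0"
    using assms by (auto simp: complex_eq_iff)
  then have "ideal_point p q = ideal_point r s \<longleftrightarrow>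
      Complex q p * Complex s (- r) = Complex s r * Complex q (- p)"
    by (simp add: ideal_point_def frac_eq_eq)
  also have "\<dots> \<longleftrightarrow> p * s = r * q"
    by (auto simp: complex_eq_iff algebra_simps)
  finally show ?thesis .
qed

lemma ideal_point_infinity [simp]: "ideal_point 1 0 = - 1"
  by (simp add: ideal_point_def complex_eq_iff Re_divide Im_divide)

lemma ideal_point_uminus: "ideal_point (- p) (- q) = ideal_point p q"
proof -
  have "Complex (- q) (- p) = - Complex q p" "Complex (- q) (- (- p)) = - Complex q (- p)"
    by (simp_all add: complex_eq_iff)
  then show ?thesis by (simp add: ideal_point_def)
qed

lemma cayley_0 [simp]: "cayley 0 = 1"
  by (simp add: cayley_def ideal_point_def complex_eq_iff Re_divide Im_divide)

lemma cayley_1 [simp]: "cayley 1 = \<i>"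
  by (simp add: cayley_def ideal_point_def complex_eq_iff Re_divide Im_divide power2_eq_square)

lemma cayley_eq_iff [simp]: "cayley x = cayley y \<longleftrightarrow> x = y"
  unfolding cayley_def by (subst ideal_point_eq_iff) auto

lemma cayley_neq_minus_one [simp]: "cayley x \<noteq> - 1"
  using ideal_point_eq_iff[of x 1 1 0] by (simp add: cayley_def)

lemma cayley_altdef: "cayley x = (1 + \<i> * of_real x) / (1 - \<i> * of_real x)"
  by (simp add: cayley_def ideal_point_def Complex_eq)

lemma cayley_denom_nonzero: "1 - \<i> * of_real x \<noteq> 0" "1 + \<i> * of_real x \<noteq> 0"
  by (auto simp: complex_eq_iff)

text \<open>The denominator splits into a factor in \<open>x\<close> and a factor in
  \<open>y\<close>. Such factors cancel in cross ratios, and their norms give the chordal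
  metric.\<close>

lemma cayley_diff:
  "cayley x - cayley y = 2 * \<i> * of_real (x - y) / ((1 - \<i> * of_real x) * (1 - \<i> * of_real y))"
  using cayley_denom_nonzero[of x] cayley_denom_nonzero[of y]
  by (simp add: cayley_altdef diff_frac_eq) (simp add: algebra_simps)

lemma cayley_plus_one: "cayley x + 1 = 2 / (1 - \<i> * of_real x)"
  using cayley_denom_nonzero[of x] by (simp add: cayley_altdef field_simps)

lemma norm_cayley_denom: "norm (1 - \<i> * of_real x) = sqrt (1 + x\<^sup>2)"
  by (simp add: norm_complex_def)

lemma norm_cayley_diff:
  "norm (cayley x - cayley y) = 2 * \<bar>x - y\<bar> / (sqrt (1 + x\<^sup>2) * sqrt (1 + y\<^sup>2))"
  by (simp add: cayley_diff norm_divide norm_mult norm_cayley_denom del: of_real_diff)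

lemma norm_cayley_plus_one: "norm (cayley x + 1) = 2 / sqrt (1 + x\<^sup>2)"
  by (simp add: cayley_plus_one norm_divide norm_cayley_denom)

text \<open>Half-angle substitution: up to the common factor \<open>1 / cos (\<theta> / 2)\<close>,
  numerator and denominator are \<open>cis (\<theta> / 2)\<close> and its conjugate.\<close>

lemma cayley_tan:
  assumes "cos (\<theta> / 2) \<noteq> 0"
  shows "cayley (tan (\<theta> / 2)) = cis \<theta>"
proof -
  have "cis \<theta> * cis (- (\<theta> / 2)) = cis (\<theta> / 2)" by (simp add: cis_mult)
  moreover have "1 + \<i> * of_real (tan (\<theta> / 2)) = cis (\<theta> / 2) / of_real (cos (\<theta> / 2))"
    "1 - \<i> * of_real (tan (\<theta> / 2)) = cis (- (\<theta> / 2)) / of_real (cos (\<theta> / 2))"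
    using assms by (auto simp: complex_eq_iff tan_def)
  ultimately have "cayley (tan (\<theta> / 2)) = cis \<theta> * cis (- (\<theta> / 2)) / cis (- (\<theta> / 2))"
    using assms by (simp add: cayley_altdef)
  then show ?thesis by simp
qed

lemma cayley_arctan: "cayley x = cis (2 * arctan x)"
  using cayley_tan[of "2 * arctan x"] by (simp add: tan_arctan)

lemma norm_cayley [simp]: "norm (cayley x) = 1"
  by (simp add: cayley_arctan)

lemma circle_cayley_cases:
  assumes "norm z = 1"
  obtains "z = - 1" | x where "z = cayley x"
proof (cases "cos (Arg z / 2) = 0")
  case True
  have "cis (Arg z) = z" using assms cis_Arg[of z] by (force simp: sgn_div_norm)
  moreover have "cis (Arg z) = cis (Arg z / 2) * cis (Arg z / 2)" by (simp add: cis_mult)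
  ultimately have "Re z = (cos (Arg z / 2))\<^sup>2 - (sin (Arg z / 2))\<^sup>2" "Im z = 0"
    using True by (simp_all add: complex_eq_iff power2_eq_square)
  then have "z = - 1" using True sin_cos_squared_add[of "Arg z / 2"] by (simp add: complex_eq_iff)
  then show ?thesis by (rule that)
next
  case False
  have "cis (Arg z) = z" using assms cis_Arg[of z] by (force simp: sgn_div_norm)
  then show ?thesis using cayley_tan[OF False] that(2) by metis
qed

lemma cr_cayley_infinity:
  assumes "x \<noteq> w"
  shows "cr (cayley x) (cayley y) (- 1) (cayley w) = of_real ((y - x) / (x - w))"
proof -
  have "cr (cayley x) (cayley y) (- 1) (cayley w) =
      ((cayley y - cayley x) * (cayley w + 1)) / ((cayley y + 1) * (cayley x - cayley w))"
  proof -
    have "(- 1 - cayley y) * (cayley w - cayley x) = (cayley y + 1) * (cayley x - cayley w)"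
      by algebra
    then show ?thesis by (simp add: cr_def)
  qed
  also have "\<dots> = of_real ((y - x) / (x - w))"
    unfolding cayley_diff cayley_plus_one
    using cayley_denom_nonzero[of x] cayley_denom_nonzero[of y] cayley_denom_nonzero[of w] assms
    by (simp add: divide_simps)
  finally show ?thesis .
qed

section \<open>Reflections in homogeneous coordinates and unimodular pairs\<close>

text \<open>On the boundary line the reflection is the projective involution fixing
  \<open>p / q\<close> and \<open>r / s\<close>. Its matrix has trace 0 and determinant
  \<open>- (p * s - q * r)\<^sup>2\<close>.\<close>

lemma hyp_reflection_ideal_point:
  assumes "p \<noteq> 0 \<or> q \<noteq> 0" "r \<noteq> 0 \<or> s \<noteq> 0" "x \<noteq> 0 \<or> y \<noteq> 0"
  shows "hyp_reflection (ideal_point p q) (ideal_point r s) (ideal_point x y) =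
    ideal_point ((p * s + q * r) * x - 2 * p * r * y) (2 * q * s * x - (p * s + q * r) * y)"
proof -
  define A B Z where "A = Complex q (- p)" and "B = Complex s (- r)" and "Z = Complex y (- x)"
  have nz: "A \<noteq> 0" "B \<noteq> 0" "cnj Z \<noteq> 0"
    using assms by (auto simp: A_def B_def Z_def complex_eq_iff)
  have eq: "ideal_point p q = cnj A / A" "ideal_point r s = cnj B / B"
    "cnj (ideal_point x y) = Z / cnj Z"
    by (simp_all add: ideal_point_def A_def B_def Z_def complex_cnj)
  define X Y where "X = (p * s + q * r) * x - 2 * p * r * y"
    and "Y = 2 * q * s * x - (p * s + q * r) * y"
  have "hyp_reflection (ideal_point p q) (ideal_point r s) (ideal_point x y) =
     (2 * cnj A * cnj B * Z - (cnj A * B + cnj B * A) * cnj Z) /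
     ((cnj A * B + cnj B * A) * Z - 2 * A * B * cnj Z)"
    (is "_ = ?N / ?D")
  proof -
    have "2 * (cnj A / A) * (cnj B / B) * (Z / cnj Z) - (cnj A / A + cnj B / B) =
        ?N / (A * B * cnj Z)"
      using nz by (simp add: field_simps)
    moreover have "(cnj A / A + cnj B / B) * (Z / cnj Z) - 2 = ?D / (A * B * cnj Z)"
      using nz by (simp add: field_simps)
    ultimately show ?thesis
      using nz unfolding hyp_reflection_def eq by simp
  qed
  \<comment> \<open>Up to one constant factor, which cancels, numerator and denominator are those of
    \<open>ideal_point X Y\<close>.\<close>
  also have "?N = - 2 * \<i> * Complex Y X"
    by (simp add: A_def B_def Z_def X_def Y_def complex_eq_iff algebra_simps)
  also have "?D = - 2 * \<i> * Complex Y (- X)"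
    by (simp add: A_def B_def Z_def X_def Y_def complex_eq_iff algebra_simps)
  also have "- 2 * \<i> * Complex Y X / (- 2 * \<i> * Complex Y (- X)) = ideal_point X Y"
    by (simp add: ideal_point_def)
  finally show ?thesis unfolding X_def Y_def .
qed

text \<open>A reflection across a unimodular pair acts on homogeneous coordinates by an integer matrix of
  determinant \<open>\<plusminus> 1\<close>. Hence all vertex pairs of Farey triangles are unimodular, which
  leaves only two candidates for the third vertex of a triangle with a given edge.\<close>

definition unimodular :: "complex \<Rightarrow> complex \<Rightarrow> bool" where
  "unimodular a b \<longleftrightarrow> (\<exists>p q r s :: int.
     a = ideal_point (of_int p) (of_int q) \<and> b = ideal_point (of_int r) (of_int s) \<and>
     \<bar>p * s - q * r\<bar> = 1)"

lemma unimodular_ideal_point: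
  "\<bar>p * s - q * r\<bar> = (1::int) \<Longrightarrow> unimodular (ideal_point p q) (ideal_point r s)"
  unfolding unimodular_def by blast

lemma unimodular_commute: "unimodular a b \<longleftrightarrow> unimodular b a"
proof -
  have "unimodular b a" if "unimodular a b" for a b
  proof -
    obtain p q r s :: int where "a = ideal_point p q" "b = ideal_point r s"
      "\<bar>p * s - q * r\<bar> = 1"
      using \<open>unimodular a b\<close> unfolding unimodular_def by blast
    then show ?thesis
      using unimodular_ideal_point[of r q s p] by (simp add: abs_minus_commute mult.commute)
  qed
  then show ?thesis by blast
qed

lemma unimodular_hyp_reflection:
  assumes "unimodular a c" "unimodular x y"
  shows "unimodular (hyp_reflection a c x) (hyp_reflection a c y)"
proof -
  obtain p q r s :: int where a: "a = ideal_point p q" and c: "c = ideal_point r s"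
    and D: "\<bar>p * s - q * r\<bar> = 1"
    using assms(1) unfolding unimodular_def by blast
  obtain u v u' v' :: int where x: "x = ideal_point u v" and y: "y = ideal_point u' v'"
    and D': "\<bar>u * v' - v * u'\<bar> = 1"
    using assms(2) unfolding unimodular_def by blast
  define M where "M = (\<lambda>u v. (p * s + q * r) * u - 2 * p * r * v)"
  define N where "N = (\<lambda>u v. 2 * q * s * u - (p * s + q * r) * v)"
  have "p \<noteq> 0 \<or> q \<noteq> 0" "r \<noteq> 0 \<or> s \<noteq> 0" "u \<noteq> 0 \<or> v \<noteq> 0" "u' \<noteq> 0 \<or> v' \<noteq> 0"
    using D D' by auto
  then have "hyp_reflection a c x = ideal_point (M u v) (N u v)"
    "hyp_reflection a c y = ideal_point (M u' v') (N u' v')"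
    using hyp_reflection_ideal_point[of p q r s u v] hyp_reflection_ideal_point[of p q r s u' v']
    by (simp_all add: a c x y M_def N_def)
  moreover have "M u v * N u' v' - N u v * M u' v' = - ((p * s - q * r)\<^sup>2 * (u * v' - v * u'))"
    by (simp add: M_def N_def power2_eq_square algebra_simps)
  then have "\<bar>M u v * N u' v' - N u v * M u' v'\<bar> = 1"
    using D D' by (simp add: abs_mult abs_square_eq_1 flip: power2_abs[of "p * s - q * r"])
  ultimately show ?thesis unfolding unimodular_def by blast
qed

text \<open>Induction along the reflections: the endpoints of the mirror are two vertices of the
  reflected triangle, hence unimodular by the induction hypothesis, so
  \<open>unimodular_hyp_reflection\<close> applies.\<close>

lemma farey_triangle_unimodular:
  assumes "t \<in> farey_triangles" "x \<in> t" "y \<in> t" "x \<noteq> y"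
  shows "unimodular x y"
  using assms
proof (induction arbitrary: x y)
  case base
  \<comment> \<open>The base triangle has the vertices 0/1, 1/1 and 1/0.\<close>
  have "ideal_point 0 1 = 1" "ideal_point 1 1 = \<i>"
    using cayley_0 cayley_1 by (simp_all add: cayley_def)
  then have "unimodular 1 \<i>" "unimodular \<i> (- 1)" "unimodular 1 (- 1)"
    using unimodular_ideal_point[of 0 1 1 1] unimodular_ideal_point[of 1 0 1 1]
      unimodular_ideal_point[of 0 0 1 1] by simp_all
  moreover from this have "unimodular \<i> 1" "unimodular (- 1) \<i>" "unimodular (- 1) 1"
    by (simp_all add: unimodular_commute)
  ultimately show ?case using base by auto
next
  case (reflect t a c)
  then obtain x' y' where "x' \<in> t" "y' \<in> t" "x = hyp_reflection a c x'"
    "y = hyp_reflection a c y'" by blast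
  with reflect show ?case by (metis unimodular_hyp_reflection)
qed

section \<open>The fan of triangles at infinity\<close>

lemma hyp_reflection_cayley_infinity:
  "hyp_reflection (cayley m) (- 1) (cayley x) = cayley (2 * m - x)"
  "hyp_reflection (cayley m) (- 1) (- 1) = - 1"
  using hyp_reflection_ideal_point[of m 1 1 0 x 1] hyp_reflection_ideal_point[of m 1 1 0 1 0]
    ideal_point_uminus[of "2 * m - x" 1]
  by (simp_all add: cayley_def)

text \<open>The base triangle is the case 0; reflecting a triangle of the fan in its right vertical
  side gives the next one.\<close>

lemma fan_triangle: "{cayley (real n), cayley (real n + 1), - 1} \<in> farey_triangles"
proof (induction n)
  case 0
  then show ?case using farey_triangles.base by simp
next
  case (Suc n)
  have "hyp_reflection (cayley (real n + 1)) (- 1) ` {cayley (real n), cayley (real n + 1), - 1}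
      \<in> farey_triangles"
    by (rule farey_triangles.reflect[OF Suc]) auto
  moreover have "2 * (real n + 1) - real n = real n + 2" "2 * (real n + 1) - (real n + 1) = real n + 1"
    by simp_all
  ultimately show ?case
    by (simp add: hyp_reflection_cayley_infinity insert_commute add_ac)
qed

text \<open>Unimodularity with infinity forces the denominator of \<open>e\<close> to be 1 or -1, so
  \<open>e\<close> lies over an integer \<open>m\<close>; unimodularity with \<open>n\<close> then
  says that \<open>m\<close> and \<open>n\<close> differ by 1.\<close>

lemma unimodular_infinity_cayley:
  assumes "unimodular e (- 1)" "unimodular e (cayley (of_int n))"
  shows "e = cayley (of_int n + 1) \<or> e = cayley (of_int n - 1)"
proof -
  obtain p q r s :: int where e: "e = ideal_point p q" and i: "- 1 = ideal_point r s"
    and D: "\<bar>p * s - q * r\<bar> = 1"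
    using assms(1) unfolding unimodular_def by blast
  obtain p' q' r' s' :: int where e': "e = ideal_point p' q'"
    and c: "cayley (of_int n) = ideal_point r' s'" and D': "\<bar>p' * s' - q' * r'\<bar> = 1"
    using assms(2) unfolding unimodular_def by blast
  have nz: "p \<noteq> 0 \<or> q \<noteq> 0" "r \<noteq> 0 \<or> s \<noteq> 0" "p' \<noteq> 0 \<or> q' \<noteq> 0" "r' \<noteq> 0 \<or> s' \<noteq> 0"
    using D D' by auto
  have "s = 0"
    using i nz ideal_point_eq_iff[of r s 1 0] by auto
  with D have q: "q = 1 \<or> q = - 1"
    using abs_zmult_eq_1[of q r] by (auto simp: abs_if split: if_splits)
  define m where "m = p * q"
  have e'': "e = cayley (of_int m)"
    using q ideal_point_uminus[of "of_int m" 1] by (auto simp: e cayley_def m_def)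
  then have "real_of_int m * q' = p'"
    using e' nz ideal_point_eq_iff[of m 1 p' q'] by (simp add: cayley_def)
  then have m: "p' = m * q'" by (metis of_int_eq_iff of_int_mult)
  have "real_of_int n * s' = r'"
    using c nz ideal_point_eq_iff[of n 1 r' s'] by (simp add: cayley_def)
  then have n: "r' = n * s'" by (metis of_int_eq_iff of_int_mult)
  have "p' * s' - q' * r' = q' * s' * (m - n)"
    by (simp add: m n algebra_simps)
  \<comment> \<open>An integer product of absolute value 1 has only factors of absolute value
    1.\<close>
  with D' have "\<bar>m - n\<bar> = 1"
    by (metis abs_mult abs_ge_zero zmult_eq_1_iff mult.commute abs_zmult_eq_1)
  then have "m = n + 1 \<or> m = n - 1" by linarith
  then show ?thesis using e'' by auto
qed


section \<open>Counterclockwise order on the circle\<close>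

lemma cis_eq_imp_eq:
  assumes "cis x = cis y" "0 < x" "x < 2 * pi" "0 < y" "y < 2 * pi"
  shows "x = y"
proof -
  have "cos (x - y) = 1"
    using assms(1) by (metis cis.sel(1) cis_divide cis_neq_zero cis_zero divide_self cos_zero)
  then obtain k :: int where k: "x - y = of_int k * 2 * pi"
    by (auto simp: cos_one_2pi_int)
  have "\<bar>x - y\<bar> = \<bar>real_of_int k\<bar> * (2 * pi)" by (simp add: k abs_mult)
  then have "\<bar>real_of_int k\<bar> * (2 * pi) < 1 * (2 * pi)" using assms by linarith
  then have "\<bar>real_of_int k\<bar> < 1" by (subst (asm) mult_less_cancel_right_pos) auto
  then have "k = 0" by linarith
  with k show ?thesis by simp
qed

lemma ccw_distinct:
  assumes "ccw a b c d"
  shows "a \<noteq> b" "a \<noteq> c" "a \<noteq> d" "b \<noteq> c" "b \<noteq> d" "c \<noteq> d"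
proof -
  have *: "cis x \<noteq> cis y" if "x < y" "y < x + 2 * pi" for x y
  proof
    assume "cis x = cis y"
    \<comment> \<open>Halving puts the difference into the interval from 0 to \<open>pi\<close>,
      where the sine does not vanish.\<close>
    then have "cis ((y - x) / 2) * cis ((y - x) / 2) = 1"
      by (simp add: cis_mult cis_divide[symmetric] diff_divide_distrib[symmetric])
    then have "(cis ((y - x) / 2))\<^sup>2 = 1" by (simp add: power2_eq_square)
    then have "Im (cis ((y - x) / 2)) = 0"
      by (metis power2_eq_1_iff one_complex.sel(2) uminus_complex.sel(2) minus_zero)
    moreover have "sin ((y - x) / 2) > 0" using that by (intro sin_gt_zero) auto
    ultimately show False by simp
  qed
  from assms obtain \<alpha> \<beta> \<gamma> \<delta> where "\<alpha> < \<beta>" "\<beta> < \<gamma>" "\<gamma> < \<delta>" "\<delta> < \<alpha> + 2 * pi"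
    "a = cis \<alpha>" "b = cis \<beta>" "c = cis \<gamma>" "d = cis \<delta>"
    unfolding ccw_def by blast
  then show "a \<noteq> b" "a \<noteq> c" "a \<noteq> d" "b \<noteq> c" "b \<noteq> d" "c \<noteq> d"
    using *[of \<alpha> \<beta>] *[of \<alpha> \<gamma>] *[of \<alpha> \<delta>] *[of \<beta> \<gamma>] *[of \<beta> \<delta>] *[of \<gamma> \<delta>] by auto
qed

text \<open>Measured from \<open>a\<close>, the angles of \<open>c\<close> and \<open>d\<close> lie
  strictly between 0 and \<open>2 * pi\<close> and are thus determined by the points; the two orders
  compare them in opposite ways.\<close>

lemma ccw_asym:
  assumes "ccw a b c d" "ccw a d c b"
  shows False
proof -
  from assms(1) obtain \<alpha> \<beta> \<gamma> \<delta> where 1: "\<alpha> < \<beta>" "\<beta> < \<gamma>" "\<gamma> < \<delta>" "\<delta> < \<alpha> + 2 * pi"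
    "a = cis \<alpha>" "b = cis \<beta>" "c = cis \<gamma>" "d = cis \<delta>"
    unfolding ccw_def by blast
  from assms(2) obtain \<alpha>' \<beta>' \<gamma>' \<delta>' where 2: "\<alpha>' < \<delta>'" "\<delta>' < \<gamma>'" "\<gamma>' < \<beta>'" "\<beta>' < \<alpha>' + 2 * pi"
    "a = cis \<alpha>'" "b = cis \<beta>'" "c = cis \<gamma>'" "d = cis \<delta>'"
    unfolding ccw_def by blast
  have "cis (\<gamma> - \<alpha>) = cis (\<gamma>' - \<alpha>')" "cis (\<delta> - \<alpha>) = cis (\<delta>' - \<alpha>')"
    using 1 2 by (simp_all add: cis_divide[symmetric])
  then have "\<gamma> - \<alpha> = \<gamma>' - \<alpha>'" "\<delta> - \<alpha> = \<delta>' - \<alpha>'"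
    using 1 2 by (auto intro!: cis_eq_imp_eq)
  then show False using 1 2 by simp
qed

lemma ccw_rotate:
  assumes "ccw a b c d"
  shows "ccw c d a b"
proof -
  from assms obtain \<alpha> \<beta> \<gamma> \<delta> where 1: "\<alpha> < \<beta>" "\<beta> < \<gamma>" "\<gamma> < \<delta>" "\<delta> < \<alpha> + 2 * pi"
    "a = cis \<alpha>" "b = cis \<beta>" "c = cis \<gamma>" "d = cis \<delta>"
    unfolding ccw_def by blast
  moreover have "cis (\<alpha> + 2 * pi) = a" "cis (\<beta> + 2 * pi) = b"
    using 1 by (simp_all add: complex_eq_iff)
  ultimately show ?thesis unfolding ccw_def
    by (intro exI[of _ \<gamma>] exI[of _ \<delta>] exI[of _ "\<alpha> + 2 * pi"] exI[of _ "\<beta> + 2 * pi"]) simp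
qed

lemma farey_quad_rotate: "farey_quad a b c d \<Longrightarrow> farey_quad c d a b"
  by (auto simp: farey_quad_def insert_commute intro: ccw_rotate)

lemma cr_rotate: "cr c d a b = cr a b c d"
proof -
  have "(a - d) * (b - c) = (c - b) * (d - a)" by algebra
  then show ?thesis by (simp add: cr_def mult.commute)
qed

section \<open>The vertical edges and their shears\<close>

definition fan_edge :: "nat \<Rightarrow> complex set" where
  "fan_edge n = {cayley (real n), - 1}"

lemma inj_fan_edge: "inj fan_edge"
  by (auto simp: inj_on_def fan_edge_def doubleton_eq_iff)

lemma fan_edge_in_farey_edges: "fan_edge n \<in> farey_edges"
  unfolding farey_edges_def fan_edge_def using fan_triangle[of n] cayley_neq_minus_one by blast

lemma farey_quad_fan_edge:
  "farey_quad (cayley (real n + 1)) (cayley (real n + 2)) (- 1) (cayley (real n))"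
proof -
  \<comment> \<open>Infinity sits at angle \<open>pi\<close>, between \<open>n + 2\<close> and
    \<open>n\<close> in counterclockwise order, so the angle of \<open>n\<close> is raised by a full
    turn.\<close>
  have "cayley (real n) = cis (2 * arctan (real n) + 2 * pi)" "- 1 = cis pi"
    by (simp_all add: cayley_arctan complex_eq_iff)
  moreover have "2 * arctan (real n + 2) < pi" "- pi < 2 * arctan (real n)"
    using arctan_bounded[of "real n + 2"] arctan_bounded[of "real n"] by linarith+
  moreover have "arctan (real n) < arctan (real n + 1)" "arctan (real n + 1) < arctan (real n + 2)"
    by (simp_all add: arctan_monotone)
  ultimately have "ccw (cayley (real n + 1)) (cayley (real n + 2)) (- 1) (cayley (real n))"
    unfolding ccw_def
    by (intro exI[of _ "2 * arctan (real n + 1)"] exI[of _ "2 * arctan (real n + 2)"]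
        exI[of _ pi] exI[of _ "2 * arctan (real n) + 2 * pi"]) (simp add: cayley_arctan)
  then show ?thesis
    using fan_triangle[of n] fan_triangle[of "Suc n"]
    by (simp add: farey_quad_def insert_commute add_ac)
qed

text \<open>By unimodularity \<open>b\<close> and \<open>d\<close> each lie over \<open>n\<close> or
  \<open>n + 2\<close>; they are distinct, and the orientation excludes the exchanged
  assignment.\<close>

lemma farey_quad_fan_edge_unique:
  assumes "farey_quad (cayley (real n + 1)) b (- 1) d"
  shows "b = cayley (real n + 2)" "d = cayley (real n)"
proof -
  let ?a = "cayley (real n + 1)"
  have ccw: "ccw ?a b (- 1) d" and t: "{?a, b, - 1} \<in> farey_triangles" "{?a, - 1, d} \<in> farey_triangles"
    using assms by (auto simp: farey_quad_def)
  have "b = cayley (real n + 2) \<or> b = cayley (real n)" if "{?a, b, - 1} \<in> farey_triangles"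
      "b \<noteq> ?a" "b \<noteq> - 1" for b
    using unimodular_infinity_cayley[of b "int n + 1"] that
      farey_triangle_unimodular[OF that(1), of b] by (auto simp: add_ac)
  from this[of b] this[of d] have
    "(b = cayley (real n + 2) \<or> b = cayley (real n)) \<and> (d = cayley (real n + 2) \<or> d = cayley (real n))"
    using t ccw_distinct[OF ccw] by (auto simp: insert_commute)
  moreover have "ccw ?a (cayley (real n + 2)) (- 1) (cayley (real n))"
    using farey_quad_fan_edge[of n] by (simp add: farey_quad_def)
  ultimately show "b = cayley (real n + 2)" "d = cayley (real n)"
    using ccw ccw_asym ccw_distinct(5)[OF ccw] by metis+
qed

text \<open>The description by \<open>THE\<close> is legitimate because the quad is unique up to a
  rotation, under which the cross ratio is invariant. The shift to \<open>Suc n\<close> keeps the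
  left neighbour a natural number.\<close>

lemma shear_fan_edge:
  "shear h (fan_edge (Suc n)) = ln (Re (cr (h (cayley (real n + 1))) (h (cayley (real n + 2)))
     (h (- 1)) (h (cayley (real n)))))"
  unfolding shear_def
proof (rule the_equality)
  show "\<exists>a b c d. fan_edge (Suc n) = {a, c} \<and> farey_quad a b c d \<and>
      ln (Re (cr (h (cayley (real n + 1))) (h (cayley (real n + 2))) (h (- 1)) (h (cayley (real n)))))
      = ln (Re (cr (h a) (h b) (h c) (h d)))"
    using farey_quad_fan_edge[of n] by (auto simp: fan_edge_def add_ac)
next
  fix x assume "\<exists>a b c d. fan_edge (Suc n) = {a, c} \<and> farey_quad a b c d \<and>
      x = ln (Re (cr (h a) (h b) (h c) (h d)))"
  then obtain a b c d where e: "{cayley (real n + 1), - 1} = {a, c}" and q: "farey_quad a b c d"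
    and x: "x = ln (Re (cr (h a) (h b) (h c) (h d)))"
    by (auto simp: fan_edge_def add_ac)
  from e consider "a = cayley (real n + 1)" "c = - 1" | "c = cayley (real n + 1)" "a = - 1"
    by (auto simp: doubleton_eq_iff)
  then show "x = ln (Re (cr (h (cayley (real n + 1))) (h (cayley (real n + 2)))
     (h (- 1)) (h (cayley (real n)))))"
  proof cases
    case 1
    then show ?thesis using farey_quad_fan_edge_unique[of n b d] q x by simp
  next
    case 2
    then show ?thesis
      using farey_quad_fan_edge_unique[of n d b] farey_quad_rotate[OF q] x
        cr_rotate[of "h c" "h d" "h a" "h b"] by simp
  qed
qed

lemma shear_fan_edge_cayley:
  assumes "h (- 1) = - 1" "h (cayley (real n)) = cayley w" "h (cayley (real n + 1)) = cayley x"
    "h (cayley (real n + 2)) = cayley y" "x \<noteq> w"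
  shows "shear h (fan_edge (Suc n)) = ln ((y - x) / (x - w))"
  using assms by (simp add: shear_fan_edge cr_cayley_infinity del: of_real_divide of_real_diff)

section \<open>A square summable function induced by no homeomorphism\<close>

text \<open>\<open>inv fan_edge\<close> recovers the number \<open>n\<close> under a vertical edge.
  The value is the logarithm of \<open>1 / (n + 1)\<^sup>2\<close> over
  \<open>1 / n\<^sup>2\<close>, so that consecutive gaps become reciprocal squares.\<close>

definition blocking_shear :: "complex set \<Rightarrow> real" where
  "blocking_shear e = (if e \<in> range (\<lambda>n. fan_edge (Suc n))
     then 2 * ln ((real (inv fan_edge e)) / (real (inv fan_edge e) + 1)) else 0)"

lemma blocking_shear_fan_edge:
  "blocking_shear (fan_edge (Suc n)) = 2 * ln ((real n + 1) / (real n + 2))"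
  by (auto simp: blocking_shear_def inv_f_f[OF inj_fan_edge] add_ac)

text \<open>By \<open>ln u \<le> u - 1\<close> the squares are dominated by four times the
  reciprocal squares; off the fan the function vanishes.\<close>

lemma blocking_shear_square_summable: "blocking_shear \<in> square_summable"
proof -
  have sq: "(2 * ln ((real n + 1) / (real n + 2)))\<^sup>2 \<le> 4 * (1 / (real (Suc n))\<^sup>2)" for n
  proof -
    have "ln ((real n + 2) / (real n + 1)) \<le> (real n + 2) / (real n + 1) - 1"
      by (rule ln_le_minus_one) simp
    also have "\<dots> = 1 / (real n + 1)" by (simp add: field_simps)
    finally have 1: "ln ((real n + 2) / (real n + 1)) \<le> 1 / (real n + 1)" .
    have 2: "0 \<le> ln ((real n + 2) / (real n + 1))" by simp
    have "ln ((real n + 1) / (real n + 2)) = - ln ((real n + 2) / (real n + 1))"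
      by (simp add: ln_div)
    then show ?thesis using power_mono[OF 1 2, of 2]
      by (simp add: power_mult_distrib power_divide add_ac)
  qed
  have "summable (\<lambda>n. 4 * (1 / (real (Suc n))\<^sup>2))"
    using inverse_squares_sums[THEN sums_summable] by (intro summable_mult) (simp add: add_ac)
  then have "summable (\<lambda>n. (2 * ln ((real n + 1) / (real n + 2)))\<^sup>2)"
    by (rule summable_comparison_test'[where N = 0]) (use sq in auto)
  then have "(\<lambda>n. (blocking_shear (fan_edge (Suc n)))\<^sup>2) summable_on UNIV"
    by (simp add: blocking_shear_fan_edge summable_on_UNIV_nonneg_real_iff)
  moreover have "inj (\<lambda>n. fan_edge (Suc n))"
    using inj_fan_edge by (auto simp: inj_on_def)
  ultimately have "(\<lambda>e. (blocking_shear e)\<^sup>2) summable_on range (\<lambda>n. fan_edge (Suc n))"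
    by (subst summable_on_reindex) (auto simp: o_def)
  also have "?this \<longleftrightarrow> (\<lambda>e. (blocking_shear e)\<^sup>2) summable_on farey_edges"
    by (rule summable_on_cong_neutral)
      (use fan_edge_in_farey_edges in \<open>auto simp: blocking_shear_def\<close>)
  finally show ?thesis by (simp add: square_summable_def)
qed

text \<open>In Cayley coordinates the images of the natural numbers have gaps of summable length, so
  they stay away from -1, although the points themselves converge to the fixed point -1.\<close>

lemma blocking_shear_not_induced:
  assumes h: "normalized_circle_homeo h" and s: "\<And>e. e \<in> farey_edges \<Longrightarrow> shear h e = blocking_shear e"
  shows False
proof -
  obtain g where g: "homeomorphism (sphere 0 1) (sphere 0 1) h g"
    and h_fix: "h (- 1) = - 1" "h \<i> = \<i>" "h 1 = 1"
    using h by (auto simp: normalized_circle_homeo_def orientation_preserving_circle_homeo_def)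
  have cont: "continuous_on (sphere 0 1) h" and inj: "inj_on h (sphere 0 1)"
    and img: "h ` sphere 0 1 = sphere 0 1"
    using g by (auto simp: homeomorphism_def intro: inj_on_inverseI)
  \<comment> \<open>Injectivity and \<open>h (- 1) = - 1\<close> keep these images away from
    infinity, so they have a real coordinate.\<close>
  have "\<exists>y. h (cayley (real n)) = cayley y" for n
  proof -
    have "cayley (real n) \<in> sphere 0 1" "- 1 \<in> sphere (0::complex) 1" by simp_all
    then have "norm (h (cayley (real n))) = 1" "h (cayley (real n)) \<noteq> - 1"
      using img inj_onD[OF inj, of "cayley (real n)" "- 1"] h_fix by auto
    then show ?thesis using circle_cayley_cases by metis
  qed
  then obtain y where y: "\<And>n. h (cayley (real n)) = cayley (y n)" by metis
  \<comment> \<open>The normalization at 1 and at the imaginary unit makes the first gap 1, which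
    starts the recursion.\<close>
  have "y 0 = 0" "y 1 = 1" using y[of 0] y[of 1] h_fix
    by (auto simp: cayley_eq_iff[symmetric] simp del: cayley_eq_iff)
  have neq: "y (Suc n) \<noteq> y n" for n
    using inj_onD[OF inj, of "cayley (real (Suc n))" "cayley (real n)"] y[of n] y[of "Suc n"] by auto
  have ratio: "\<bar>y (Suc (Suc n)) - y (Suc n)\<bar> = ((real n + 1) / (real n + 2))\<^sup>2 * \<bar>y (Suc n) - y n\<bar>" for n
  proof -
    let ?r = "(y (Suc (Suc n)) - y (Suc n)) / (y (Suc n) - y n)"
    have "ln ?r = 2 * ln ((real n + 1) / (real n + 2))"
      using shear_fan_edge_cayley[of h n "y n" "y (Suc n)" "y (Suc (Suc n))"] h_fix neq[of n]
        y[of n] y[of "Suc n"] y[of "Suc (Suc n)"] s[OF fan_edge_in_farey_edges, of "Suc n"]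
      by (simp add: blocking_shear_fan_edge add_ac)
    \<comment> \<open>\<open>ln\<close> is even on the reals, so the sign of \<open>?r\<close> remains undetermined; the lengths suffice\<close>
    moreover have "ln \<bar>?r\<bar> = ln ?r" by (simp add: abs_if ln_minus)
    moreover have "\<bar>?r\<bar> > 0" using neq[of n] neq[of "Suc n"] by simp
    ultimately have "\<bar>?r\<bar> = exp (2 * ln ((real n + 1) / (real n + 2)))"
      by (metis exp_ln)
    also have "\<dots> = ((real n + 1) / (real n + 2))\<^sup>2"
      by (simp add: exp_double)
    finally show ?thesis using neq[of n] by (simp add: abs_divide field_simps)
  qed
  have step: "\<bar>y (Suc n) - y n\<bar> = 1 / (real n + 1)\<^sup>2" for n
  proof (induction n)
    case 0
    then show ?case using \<open>y 0 = 0\<close> \<open>y 1 = 1\<close> by simp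
  next
    case (Suc n)
    then show ?case using ratio[of n] by (simp add: power_divide add_ac)
  qed
  have bound: "\<bar>y (Suc n)\<bar> \<le> 2 - 1 / (real n + 1)" for n
  proof (induction n)
    case 0
    then show ?case using \<open>y 1 = 1\<close> by simp
  next
    case (Suc n)
    \<comment> \<open>Comparison with a telescoping term explains the form of the bound.\<close>
    have "1 / (real n + 2)\<^sup>2 \<le> 1 / ((real n + 1) * (real n + 2))"
      by (intro divide_left_mono) (auto simp: power2_eq_square intro!: mult_right_mono)
    also have "\<dots> = 1 / (real n + 1) - 1 / (real n + 2)" by (simp add: field_simps)
    finally show ?case using Suc step[of "Suc n"] by (simp add: add_ac)
  qed
  have "(\<lambda>n. cayley (real (Suc n))) \<longlonglongrightarrow> - 1"
  proof -
    have "(\<lambda>n. 2 / sqrt (1 + (real (Suc n))\<^sup>2)) \<longlonglongrightarrow> 0"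
      by real_asymp
    then have "(\<lambda>n. norm (cayley (real (Suc n)) - (- 1))) \<longlonglongrightarrow> 0"
      by (simp add: norm_cayley_plus_one)
    then show ?thesis by (simp only: LIM_zero_iff tendsto_norm_zero_iff)
  qed
  then have "(\<lambda>n. h (cayley (real (Suc n)))) \<longlonglongrightarrow> h (- 1)"
    by (rule continuous_on_tendsto_compose[OF cont]) auto
  then have "(\<lambda>n. norm (h (cayley (real (Suc n))) - (- 1))) \<longlonglongrightarrow> 0"
    using h_fix by (metis LIM_zero_iff tendsto_norm_zero_iff)
  \<comment> \<open>\<open>2 / sqrt 5\<close> is the distance from -1 to \<open>cayley 2\<close>,
    hence a lower bound for all coordinates of absolute value at most 2.\<close>
  then have "eventually (\<lambda>n. norm (h (cayley (real (Suc n))) - (- 1)) < 2 / sqrt 5) sequentially"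
    by (rule order_tendstoD) simp
  then obtain n where n: "norm (h (cayley (real (Suc n))) - (- 1)) < 2 / sqrt 5"
    using eventually_happens'[OF sequentially_bot] by blast
  have "0 \<le> 1 / (real n + 1)" by simp
  with bound[of n] have "\<bar>y (Suc n)\<bar> \<le> 2" by linarith
  then have "(y (Suc n))\<^sup>2 \<le> 2\<^sup>2" by (metis abs_le_square_iff abs_numeral)
  then have "2 / sqrt 5 \<le> 2 / sqrt (1 + (y (Suc n))\<^sup>2)"
    by (intro divide_left_mono real_sqrt_le_mono mult_pos_pos) (auto intro: add_pos_nonneg)
  then show False using n by (simp add: y norm_cayley_plus_one del: of_nat_Suc)
qed

section \<open>Bounded perturbations of the line as circle maps\<close>

text \<open>The tangent addition formula, as multiplication on the circle adds the angles
  \<open>2 * arctan x\<close> and \<open>2 * arctan w\<close>.\<close>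

lemma cayley_mult:
  assumes "x * w \<noteq> 1"
  shows "cayley x * cayley w = cayley ((x + w) / (1 - x * w))"
proof -
  have "1 - x * w \<noteq> 0" using assms by simp
  then have nz: "complex_of_real (1 - x * w) \<noteq> 0" by (simp only: of_real_eq_0_iff not_False_eq_True)
  define D where "D = complex_of_real (1 - x * w)"
  have "(1 + \<i> * x) * (1 + \<i> * w) = D * (1 + \<i> * of_real ((x + w) / (1 - x * w)))"
    "(1 - \<i> * x) * (1 - \<i> * w) = D * (1 - \<i> * of_real ((x + w) / (1 - x * w)))"
    using \<open>1 - x * w \<noteq> 0\<close> by (simp_all add: D_def complex_eq_iff)
  then show ?thesis
    using nz unfolding cayley_altdef times_divide_times_eq by (simp add: D_def)
qed

lemma Re_cayley: "Re (cayley x) = (1 - x\<^sup>2) / (1 + x\<^sup>2)"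
  and Im_cayley: "Im (cayley x) = 2 * x / (1 + x\<^sup>2)"
  by (simp_all add: cayley_def ideal_point_def Re_divide Im_divide power2_eq_square)

text \<open>The constant 1/2 makes \<open>x + g x\<close> bi-Lipschitz, boundedness makes the
  rotation angle vanish at infinity, and \<open>g 0 = 0\<close> makes \<open>x + g x\<close>
  comparable in size to \<open>x\<close>.\<close>

locale line_perturbation =
  fixes g :: "real \<Rightarrow> real"
  assumes lip: "\<bar>g x - g y\<bar> \<le> \<bar>x - y\<bar> / 2"
    and bounded: "\<bar>g x\<bar> \<le> 1"
    and zero: "g 0 = 0"
begin

text \<open>The map \<open>x \<mapsto> x + g x\<close> of the line, transported to the circle, rotates a point \<open>z\<close> by
  \<open>angle z\<close>, which is computed from the difference formula for the arctangent. This global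
  formula (at \<open>z = -1\<close> the junk value of the quotient is multiplied by \<open>0\<close>) makes the
  lift to the universal cover explicit.\<close>

definition angle :: "complex \<Rightarrow> real" where
  "angle z = 2 * arctan ((1 + Re z) * g (Im z / (1 + Re z)) / (2 + Im z * g (Im z / (1 + Re z))))"

definition circle_map :: "complex \<Rightarrow> complex" where
  "circle_map z = z * cis (angle z)"

definition circle_lift :: "real \<Rightarrow> real" where
  "circle_lift \<theta> = \<theta> + angle (cis \<theta>)"

lemma circle_map_cis: "circle_map (cis \<theta>) = cis (circle_lift \<theta>)"
  by (simp add: circle_map_def circle_lift_def cis_mult)

lemma circle_map_minus_one [simp]: "circle_map (- 1) = - 1"
  by (simp add: circle_map_def angle_def)

text \<open>The number \<open>w\<close> is the tangent of
  \<open>arctan (x + g x) - arctan x\<close>. The map multiplies by \<open>cayley w\<close>, and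
  \<open>cayley_mult\<close> leads back to \<open>x + g x\<close>.\<close>

lemma circle_map_cayley: "circle_map (cayley x) = cayley (x + g x)"
proof -
  have pos: "1 + x\<^sup>2 > 0" by (simp add: add_pos_nonneg)
  have pos': "1 + x\<^sup>2 + x * g x > 0"
  proof -
    have "\<bar>x * g x\<bar> \<le> \<bar>x\<bar> * 1" unfolding abs_mult by (intro mult_left_mono bounded) auto
    moreover have "\<bar>x\<bar> < 1 + x\<^sup>2"
      using zero_le_power2[of "\<bar>x\<bar> - 1 / 2"] by (simp add: power2_eq_square algebra_simps)
    ultimately show ?thesis by linarith
  qed
  have Re: "1 + Re (cayley x) = 2 / (1 + x\<^sup>2)" using pos by (simp add: Re_cayley field_simps)
  have arg: "Im (cayley x) / (1 + Re (cayley x)) = x"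
    unfolding Re using pos by (simp add: Im_cayley)
  define w where "w = g x / (1 + x\<^sup>2 + x * g x)"
  have "2 + 2 * x / (1 + x\<^sup>2) * g x = 2 * (1 + x\<^sup>2 + x * g x) / (1 + x\<^sup>2)"
    using pos by (simp add: field_simps)
  moreover have "2 / p * g x / (2 * q / p) = g x / q" if "p > 0" for p q :: real
    using that by simp
  ultimately have "2 / (1 + x\<^sup>2) * g x / (2 + 2 * x / (1 + x\<^sup>2) * g x) = w"
    using pos by (simp only: w_def)
  then have "angle (cayley x) = 2 * arctan w"
    by (simp only: angle_def arg) (simp only: Re Im_cayley)
  then have "circle_map (cayley x) = cayley x * cayley w"
    by (simp add: circle_map_def cayley_arctan)
  have 1: "1 - x * w = (1 + x\<^sup>2) / (1 + x\<^sup>2 + x * g x)"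
    using pos' by (simp add: w_def field_simps)
  then have "1 - x * w \<noteq> 0" using pos pos' by simp
  then have "x * w \<noteq> 1" by simp
  have 2: "x + w = (x + g x) * (1 + x\<^sup>2) / (1 + x\<^sup>2 + x * g x)"
    using pos' by (simp add: w_def field_simps power2_eq_square)
  have "(x + w) / (1 - x * w) = x + g x"
    unfolding 1 2 using pos pos' by simp
  then show ?thesis
    using cayley_mult[OF \<open>x * w \<noteq> 1\<close>] \<open>circle_map (cayley x) = cayley x * cayley w\<close> by simp
qed

lemma line_map_bilipschitz:
  "\<bar>x - y\<bar> / 2 \<le> \<bar>(x + g x) - (y + g y)\<bar>" "\<bar>(x + g x) - (y + g y)\<bar> \<le> 3 / 2 * \<bar>x - y\<bar>"
proof -
  have "\<bar>d\<bar> / 2 \<le> \<bar>d + e\<bar> \<and> \<bar>d + e\<bar> \<le> 3 / 2 * \<bar>d\<bar>" if "\<bar>e\<bar> \<le> \<bar>d\<bar> / 2" for d e :: real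
    using that by linarith
  moreover have "(x + g x) - (y + g y) = (x - y) + (g x - g y)" by simp
  ultimately show "\<bar>x - y\<bar> / 2 \<le> \<bar>(x + g x) - (y + g y)\<bar>"
    "\<bar>(x + g x) - (y + g y)\<bar> \<le> 3 / 2 * \<bar>x - y\<bar>"
    using lip[of x y] by metis+
qed

text \<open>Controls the denominators in \<open>norm_cayley_diff\<close>. The Lipschitz bound
  against the fixed origin compares \<open>x + g x\<close> with \<open>x\<close>, and the factors
  1/2 and 3/2 also absorb the summand 1.\<close>

lemma sqrt_line_map:
  "sqrt (1 + x\<^sup>2) / 2 \<le> sqrt (1 + (x + g x)\<^sup>2)" "sqrt (1 + (x + g x)\<^sup>2) \<le> 3 / 2 * sqrt (1 + x\<^sup>2)"
proof -
  have "\<bar>x / 2\<bar> \<le> \<bar>x + g x\<bar>" "\<bar>x + g x\<bar> \<le> \<bar>3 / 2 * x\<bar>"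
    using lip[of x 0] zero by (auto simp: abs_if split: if_splits)
  then have "(x / 2)\<^sup>2 \<le> (x + g x)\<^sup>2" "(x + g x)\<^sup>2 \<le> (3 / 2 * x)\<^sup>2"
    by (simp_all only: abs_le_square_iff)
  then have "(1 + x\<^sup>2) / 2\<^sup>2 \<le> 1 + (x + g x)\<^sup>2" "1 + (x + g x)\<^sup>2 \<le> (3 / 2)\<^sup>2 * (1 + x\<^sup>2)"
    by (simp_all add: power_divide power_mult_distrib)
  then have "sqrt ((1 + x\<^sup>2) / 2\<^sup>2) \<le> sqrt (1 + (x + g x)\<^sup>2)"
    "sqrt (1 + (x + g x)\<^sup>2) \<le> sqrt ((3 / 2)\<^sup>2 * (1 + x\<^sup>2))"
    by (simp_all only: real_sqrt_le_iff)
  then show "sqrt (1 + x\<^sup>2) / 2 \<le> sqrt (1 + (x + g x)\<^sup>2)"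
    "sqrt (1 + (x + g x)\<^sup>2) \<le> 3 / 2 * sqrt (1 + x\<^sup>2)"
    by (simp_all only: real_sqrt_mult real_sqrt_divide real_sqrt_abs)
qed

text \<open>The coordinate difference and both roots change by factors between 1/2 and 3/2. This
  gives (3/2) / (1/4) = 6 in one direction and (9/4) / (1/2) = 9/2, rounded up to 6, in the
  other.\<close>

lemma circle_map_bilipschitz_cayley:
  "norm (circle_map (cayley x) - circle_map (cayley y)) \<le> 6 * norm (cayley x - cayley y)"
  "norm (cayley x - cayley y) \<le> 6 * norm (circle_map (cayley x) - circle_map (cayley y))"
proof -
  define A A' B B' where "A = sqrt (1 + x\<^sup>2)" and "A' = sqrt (1 + (x + g x)\<^sup>2)"
    and "B = sqrt (1 + y\<^sup>2)" and "B' = sqrt (1 + (y + g y)\<^sup>2)"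
  define d d' where "d = \<bar>x - y\<bar>" and "d' = \<bar>(x + g x) - (y + g y)\<bar>"
  have pos: "A > 0" "B > 0" "A' > 0" "B' > 0"
    by (auto simp: A_def B_def A'_def B'_def intro: add_pos_nonneg)
  have d: "0 \<le> d" "d / 2 \<le> d'" "d' \<le> 3 / 2 * d"
    using line_map_bilipschitz[of x y] by (auto simp: d_def d'_def)
  have A: "A / 2 \<le> A'" "A' \<le> 3 / 2 * A" and B: "B / 2 \<le> B'" "B' \<le> 3 / 2 * B"
    using sqrt_line_map by (auto simp: A_def B_def A'_def B'_def)
  have lower: "A / 2 * (B / 2) \<le> A' * B'" and upper: "A' * B' \<le> 3 / 2 * A * (3 / 2 * B)"
    using mult_mono[OF A(1) B(1)] mult_mono[OF A(2) B(2)] pos by simp_all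
  have "2 * d' / (A' * B') \<le> 2 * (3 / 2 * d) / (A / 2 * (B / 2))"
    using d lower pos by (intro frac_le) auto
  then show "norm (circle_map (cayley x) - circle_map (cayley y)) \<le> 6 * norm (cayley x - cayley y)"
    unfolding circle_map_cayley norm_cayley_diff A_def[symmetric] A'_def[symmetric]
      B_def[symmetric] B'_def[symmetric] d_def[symmetric] d'_def[symmetric]
    using pos by simp
  have "2 * (d / 2) / (3 / 2 * A * (3 / 2 * B)) \<le> 2 * d' / (A' * B')"
    using d upper pos by (intro frac_le) auto
  moreover have "2 * d / (A * B) \<le> 6 * (2 * (d / 2) / (3 / 2 * A * (3 / 2 * B)))"
    using d pos by (simp add: divide_simps)
  ultimately show "norm (cayley x - cayley y) \<le> 6 * norm (circle_map (cayley x) - circle_map (cayley y))"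
    unfolding circle_map_cayley norm_cayley_diff A_def[symmetric] A'_def[symmetric]
      B_def[symmetric] B'_def[symmetric] d_def[symmetric] d'_def[symmetric]
    by linarith
qed

lemma circle_map_bilipschitz_infinity:
  "norm (circle_map (cayley x) - (- 1)) \<le> 6 * norm (cayley x - (- 1))"
  "norm (cayley x - (- 1)) \<le> 6 * norm (circle_map (cayley x) - (- 1))"
proof -
  define A A' where "A = sqrt (1 + x\<^sup>2)" and "A' = sqrt (1 + (x + g x)\<^sup>2)"
  have pos: "A > 0" "A' > 0"
    by (auto simp: A_def A'_def intro: add_pos_nonneg)
  have A: "A / 2 \<le> A'" "A' \<le> 3 / 2 * A"
    using sqrt_line_map by (auto simp: A_def A'_def)
  have "2 / A' \<le> 6 * (2 / A)" "2 / A \<le> 6 * (2 / A')"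
    using A pos by (auto simp: field_simps)
  then show "norm (circle_map (cayley x) - (- 1)) \<le> 6 * norm (cayley x - (- 1))"
    "norm (cayley x - (- 1)) \<le> 6 * norm (circle_map (cayley x) - (- 1))"
    by (simp_all add: circle_map_cayley norm_cayley_plus_one A_def A'_def)
qed

lemma circle_map_bilipschitz:
  assumes "norm z = 1" "norm w = 1"
  shows "norm (circle_map z - circle_map w) \<le> 6 * norm (z - w) \<and>
    norm (z - w) \<le> 6 * norm (circle_map z - circle_map w)"
proof (cases rule: circle_cayley_cases[OF assms(1)])
  case 1
  then show ?thesis
    using circle_map_bilipschitz_infinity
    by (cases rule: circle_cayley_cases[OF assms(2)])
      (auto simp: norm_minus_commute[of "- 1"] simp del: diff_minus_eq_add)
next
  case (2 x)
  then show ?thesis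
    using circle_map_bilipschitz_infinity circle_map_bilipschitz_cayley
    by (cases rule: circle_cayley_cases[OF assms(2)]) (auto simp del: diff_minus_eq_add)
qed

lemma inj_on_circle_map: "inj_on circle_map (sphere 0 1)"
proof (rule inj_onI)
  fix z w :: complex
  assume "z \<in> sphere 0 1" "w \<in> sphere 0 1" "circle_map z = circle_map w"
  then show "z = w" using circle_map_bilipschitz[of z w] by simp
qed

lemma continuous_on_circle_map: "continuous_on (sphere 0 1) circle_map"
proof -
  have "6-lipschitz_on (sphere 0 1) circle_map"
    using circle_map_bilipschitz by (intro lipschitz_onI) (auto simp: dist_norm)
  then show ?thesis by (rule lipschitz_on_continuous_on)
qed

lemma isCont_g: "isCont g x"
proof -
  have "(1/2)-lipschitz_on UNIV g"
    using lip by (intro lipschitz_onI) (auto simp: dist_norm)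
  then show ?thesis
    using lipschitz_on_continuous_on continuous_on_eq_continuous_at open_UNIV by blast
qed

lemma circle_map_image: "circle_map ` sphere 0 1 = sphere 0 1"
proof
  show "circle_map ` sphere 0 1 \<subseteq> sphere 0 1"
    by (auto simp: circle_map_def norm_mult)
  show "sphere 0 1 \<subseteq> circle_map ` sphere 0 1"
  proof
    fix z :: complex assume "z \<in> sphere 0 1"
    then have "norm z = 1" by simp
    then show "z \<in> circle_map ` sphere 0 1"
    proof (cases rule: circle_cayley_cases)
      case 1
      then show ?thesis by (intro image_eqI[of _ _ "- 1"]) auto
    next
      case (2 y)
      \<comment> \<open>Since \<open>g\<close> moves points by at most 1, the values at
        \<open>y - 1\<close> and \<open>y + 1\<close> enclose \<open>y\<close>.\<close>
      have "\<exists>x\<ge>y - 1. x \<le> y + 1 \<and> x + g x = y"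
        using bounded[of "y - 1"] bounded[of "y + 1"] isCont_g
        by (intro IVT) auto
      then obtain x where "x + g x = y" by blast
      then show ?thesis using 2 by (intro image_eqI[of _ _ "cayley x"]) (auto simp: circle_map_cayley)
    qed
  qed
qed

text \<open>Where the cosine is -1 the argument of \<open>g\<close> is singular, but
  \<open>g\<close> is bounded and \<open>a\<close> vanishes there, so the product tends to 0, its
  value at that angle. Elsewhere this is a composition of continuous maps.\<close>

lemma isCont_mult_g:
  assumes a: "isCont a \<theta>" "cos \<theta> = - 1 \<Longrightarrow> a \<theta> = 0"
  shows "isCont (\<lambda>\<theta>. a \<theta> * g (sin \<theta> / (1 + cos \<theta>))) \<theta>"
proof (cases "cos \<theta> = - 1")
  case True
  have "(a \<longlongrightarrow> 0) (at \<theta>)" using a True by (simp add: isCont_def)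
  then have "((\<lambda>\<theta>. \<bar>a \<theta>\<bar>) \<longlongrightarrow> 0) (at \<theta>)" by (rule tendsto_rabs_zero)
  moreover have "\<bar>a \<theta> * g (sin \<theta> / (1 + cos \<theta>))\<bar> \<le> \<bar>a \<theta>\<bar>" for \<theta>
    using mult_left_mono[OF bounded, of "\<bar>a \<theta>\<bar>"] by (simp add: abs_mult)
  ultimately have "((\<lambda>\<theta>. a \<theta> * g (sin \<theta> / (1 + cos \<theta>))) \<longlongrightarrow> 0) (at \<theta>)"
    by (rule_tac Lim_null_comparison) (auto intro!: always_eventually)
  then show ?thesis using a True by (simp add: isCont_def)
next
  case False
  then have "1 + cos \<theta> \<noteq> 0" by linarith
  then have "isCont (\<lambda>\<theta>. g (sin \<theta> / (1 + cos \<theta>))) \<theta>"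
    by (intro isCont_o2[OF _ isCont_g] continuous_intros) auto
  then show ?thesis using a(1) by (intro continuous_intros)
qed

lemma continuous_on_circle_lift: "continuous_on UNIV circle_lift"
proof -
  have "isCont circle_lift \<theta>" for \<theta>
  proof -
    let ?m = "\<lambda>\<theta>. (1 + cos \<theta>) * g (sin \<theta> / (1 + cos \<theta>))"
    let ?n = "\<lambda>\<theta>. sin \<theta> * g (sin \<theta> / (1 + cos \<theta>))"
    have "isCont ?m \<theta>" by (intro isCont_mult_g continuous_intros) auto
    moreover have "isCont ?n \<theta>"
      by (intro isCont_mult_g continuous_intros) (use sin_squared_eq[of \<theta>] in auto)
    moreover have "2 + ?n \<theta> \<noteq> 0"
    proof -
      have "\<bar>?n \<theta>\<bar> \<le> 1 * 1" unfolding abs_mult by (intro mult_mono bounded) auto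
      then show ?thesis by linarith
    qed
    moreover have "isCont (\<lambda>\<theta>. \<theta> + 2 * arctan (m \<theta> / (2 + n \<theta>))) \<theta>"
      if "isCont m \<theta>" "isCont n \<theta>" "2 + n \<theta> \<noteq> 0" for m n
      using that by (intro continuous_intros)
    ultimately have "isCont (\<lambda>\<theta>. \<theta> + 2 * arctan (?m \<theta> / (2 + ?n \<theta>))) \<theta>"
      by blast
    then show ?thesis by (simp add: circle_lift_def[abs_def] angle_def)
  qed
  then show ?thesis by (simp add: continuous_at_imp_continuous_on)
qed

text \<open>The lift is injective and fixes arbitrarily large multiples of \<open>2 * pi\<close>. A
  failure of monotonicity at \<open>x < y\<close> would make it take the value at \<open>x\<close>
  again beyond \<open>y\<close>.\<close>

lemma strict_mono_circle_lift: "strict_mono circle_lift"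
proof (rule strict_monoI, rule ccontr)
  fix x y :: real assume "x < y" "\<not> circle_lift x < circle_lift y"
  have inj: "u = v" if "circle_lift u = circle_lift v" for u v
  proof -
    have "circle_map (cis u) = circle_map (cis v)" using that by (simp add: circle_map_cis)
    then have "cis u = cis v" by (rule inj_onD[OF inj_on_circle_map]) auto
    \<comment> \<open>\<open>angle\<close> depends only on the point of the circle, so it cancels
      from the equal lifts.\<close>
    then show ?thesis using that by (simp add: circle_lift_def)
  qed
  obtain N :: nat where "max \<bar>y\<bar> \<bar>circle_lift x\<bar> < real N" using reals_Archimedean2 by blast
  moreover define M where "M = 2 * pi * real N"
  moreover have "real N * 1 \<le> real N * (2 * pi)" using pi_gt3 by (intro mult_left_mono) auto
  ultimately have M: "y < M" "circle_lift x < M" by (auto simp: mult_ac)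
  have "cis M = 1" unfolding M_def by (intro cis_multiple_2pi) auto
  \<comment> \<open>\<open>M\<close> lies over the point 1, whose coordinate is 0, where
    \<open>g\<close> vanishes.\<close>
  then have "circle_lift M = M" by (simp add: circle_lift_def angle_def zero)
  then have "\<exists>z\<ge>y. z \<le> M \<and> circle_lift z = circle_lift x"
    using M \<open>\<not> circle_lift x < circle_lift y\<close> continuous_on_circle_lift
    by (intro IVT) (auto simp: continuous_on_eq_continuous_at)
  then show False using inj \<open>x < y\<close> by force
qed

lemma circle_homeo_circle_map: "orientation_preserving_circle_homeo circle_map"
  unfolding orientation_preserving_circle_homeo_def
  using homeomorphism_compact[OF compact_sphere continuous_on_circle_map circle_map_image inj_on_circle_map]
    continuous_on_circle_lift strict_mono_circle_lift circle_map_cis by blast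

text \<open>The two adjacent chords have equal length \<open>c\<close>; the bi-Lipschitz constant 6,
  applied to both, bounds the ratio of their images by 36.\<close>

lemma quasisymmetric_circle_map: "quasisymmetric circle_map"
proof -
  have "1 / 36 \<le> q \<and> q \<le> 36" if t: "0 < t" "t < pi"
    and q: "q = norm (circle_map (cis (\<theta> + t)) - circle_map (cis \<theta>)) /
      norm (circle_map (cis \<theta>) - circle_map (cis (\<theta> - t)))" for \<theta> t q
  proof -
    define c where "c = norm (cis t - 1)"
    have "cis (\<theta> + t) - cis \<theta> = cis \<theta> * (cis t - 1)"
      by (simp add: cis_mult[symmetric] algebra_simps)
    then have 1: "norm (cis (\<theta> + t) - cis \<theta>) = c" by (simp add: c_def norm_mult)
    have "cis \<theta> - cis (\<theta> - t) = cis (\<theta> - t) * (cis t - 1)"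
      by (simp add: cis_mult algebra_simps)
    then have 2: "norm (cis \<theta> - cis (\<theta> - t)) = c" by (simp add: c_def norm_mult)
    have "sin t > 0" using t by (intro sin_gt_zero)
    then have "c > 0" by (auto simp: c_def complex_eq_iff)
    define u v where "u = norm (circle_map (cis (\<theta> + t)) - circle_map (cis \<theta>))"
      and "v = norm (circle_map (cis \<theta>) - circle_map (cis (\<theta> - t)))"
    have "u \<le> 6 * c" "c \<le> 6 * u" "v \<le> 6 * c" "c \<le> 6 * v"
      using circle_map_bilipschitz[of "cis (\<theta> + t)" "cis \<theta>"]
        circle_map_bilipschitz[of "cis \<theta>" "cis (\<theta> - t)"] by (simp_all add: 1 2 u_def v_def)
    moreover from this have "v > 0" using \<open>c > 0\<close> by linarith
    moreover have "q = u / v" by (simp add: q u_def v_def)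
    ultimately show ?thesis by (simp add: divide_le_eq le_divide_eq)
  qed
  then show ?thesis
    unfolding quasisymmetric_def Let_def
    by (intro conjI circle_homeo_circle_map exI[of _ 36]) auto
qed

end

section \<open>A quasisymmetric map whose shear is not square summable\<close>

text \<open>A smooth function of period 4. Among the integers it is nonzero only at those congruent
  to 3 modulo 4, where the sine is -1; in particular 0 and 1 stay fixed. The factor 1/12 brings the
  Lipschitz constant down to 1/2.\<close>

definition zigzag :: "real \<Rightarrow> real" where
  "zigzag x = (sin (pi / 2 * x) - (sin (pi / 2 * x))\<^sup>2) / 12"

lemma abs_sin_diff_le: "\<bar>sin x - sin y\<bar> \<le> \<bar>x - y :: real\<bar>"
proof -
  have "\<bar>sin x - sin y\<bar> = 2 * (\<bar>sin ((x - y) / 2)\<bar> * \<bar>cos ((x + y) / 2)\<bar>)"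
    by (simp add: sin_diff_sin abs_mult)
  also have "\<dots> \<le> 2 * (\<bar>(x - y) / 2\<bar> * 1)"
    by (intro mult_left_mono mult_mono abs_sin_x_le_abs_x) auto
  finally show ?thesis by simp
qed

lemma line_perturbation_zigzag: "line_perturbation zigzag"
proof
  fix x y :: real
  define a b where "a = sin (pi / 2 * x)" and "b = sin (pi / 2 * y)"
  have ab: "\<bar>a\<bar> \<le> 1" "\<bar>b\<bar> \<le> 1" by (auto simp: a_def b_def)
  then have "\<bar>1 - (a + b)\<bar> \<le> 3" by linarith
  have "\<bar>a - b\<bar> \<le> \<bar>pi / 2 * x - pi / 2 * y\<bar>"
    unfolding a_def b_def by (rule abs_sin_diff_le)
  also have "\<dots> = pi / 2 * \<bar>x - y\<bar>"
    by (simp only: right_diff_distrib[symmetric] abs_mult) simp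
  also have "\<dots> \<le> 2 * \<bar>x - y\<bar>"
    using pi_less_4 by (intro mult_right_mono) auto
  finally have "\<bar>a - b\<bar> \<le> 2 * \<bar>x - y\<bar>" .
  then have "\<bar>a - b\<bar> * \<bar>1 - (a + b)\<bar> \<le> 2 * \<bar>x - y\<bar> * 3"
    using \<open>\<bar>1 - (a + b)\<bar> \<le> 3\<close> by (intro mult_mono) auto
  \<comment> \<open>The difference of the quadratic expressions factors; the bounds 2 and 3 on the
    factors give 2 * 3 / 12 = 1/2.\<close>
  moreover have "zigzag x - zigzag y = (a - b) * (1 - (a + b)) / 12"
    by (simp add: zigzag_def a_def b_def power2_eq_square field_simps)
  ultimately show "\<bar>zigzag x - zigzag y\<bar> \<le> \<bar>x - y\<bar> / 2"
    by (simp only: abs_mult abs_divide)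
  have "a\<^sup>2 \<le> 1" "0 \<le> a\<^sup>2" using ab by (simp_all add: abs_square_le_1)
  moreover have "zigzag x = (a - a\<^sup>2) / 12" by (simp only: zigzag_def a_def)
  moreover have "\<bar>a - a\<^sup>2\<bar> \<le> 12" using ab \<open>a\<^sup>2 \<le> 1\<close> \<open>0 \<le> a\<^sup>2\<close> by arith
  ultimately show "\<bar>zigzag x\<bar> \<le> 1" by (simp only: abs_divide) simp
  show "zigzag 0 = 0" by (simp add: zigzag_def)
qed

lemma zigzag_nat:
  "zigzag (real (4 * m + 3)) = - 1 / 6" "zigzag (real (4 * m + 3) + 1) = 0"
  "zigzag (real (4 * m + 3) + 2) = 0"
proof -
  have "pi / 2 * real (4 * m + 3) = 3 / 2 * pi + of_int (int m) * (2 * pi)"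
    "pi / 2 * (real (4 * m + 3) + 1) = 0 + of_int (int m + 1) * (2 * pi)"
    "pi / 2 * (real (4 * m + 3) + 2) = pi / 2 + of_int (int m + 1) * (2 * pi)"
    by (simp_all add: field_simps)
  then have "sin (pi / 2 * real (4 * m + 3)) = - 1" "sin (pi / 2 * (real (4 * m + 3) + 1)) = 0"
    "sin (pi / 2 * (real (4 * m + 3) + 2)) = 1"
    using sin.plus_of_int[of "3 / 2 * pi" "int m"] sin.plus_of_int[of "0 :: real" "int m + 1"]
      sin.plus_of_int[of "pi / 2" "int m + 1"] sin_3over2_pi
    by (simp_all only: sin_zero sin_pi_half of_real_eq_id id_apply)
  then show "zigzag (real (4 * m + 3)) = - 1 / 6" "zigzag (real (4 * m + 3) + 1) = 0"
    "zigzag (real (4 * m + 3) + 2) = 0"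
    by (simp_all only: zigzag_def) simp_all
qed

interpretation zigzag: line_perturbation zigzag
  by (rule line_perturbation_zigzag)

lemma normalized_zigzag: "normalized_circle_homeo zigzag.circle_map"
  using zigzag.circle_map_cayley[of 0] zigzag.circle_map_cayley[of 1]
  by (simp add: normalized_circle_homeo_def zigzag.circle_homeo_circle_map zigzag_def)

text \<open>The point over \<open>4 * m + 3\<close> moves left by 1/6 while the next two stay, so
  adjacent intervals of lengths 7/6 and 1 meet at \<open>4 * m + 4\<close>.\<close>

lemma shear_zigzag: "shear zigzag.circle_map (fan_edge (Suc (4 * m + 3))) = ln (6 / 7)"
proof -
  have "shear zigzag.circle_map (fan_edge (Suc (4 * m + 3))) =
      ln (((real (4 * m + 3) + 2) - (real (4 * m + 3) + 1)) /
          ((real (4 * m + 3) + 1) - (real (4 * m + 3) - 1 / 6)))"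
    by (rule shear_fan_edge_cayley)
      (simp_all only: zigzag.circle_map_cayley zigzag_nat zigzag.circle_map_minus_one, simp_all)
  also have "\<dots> = ln (6 / 7)" by simp
  finally show ?thesis .
qed

text \<open>Summability would pass to the subfamily of edges with shear \<open>ln (6 / 7)\<close>,
  an infinite family with a constant nonzero term.\<close>

lemma shear_zigzag_not_square_summable: "shear zigzag.circle_map \<notin> square_summable"
proof
  let ?e = "\<lambda>m. fan_edge (Suc (4 * m + 3))"
  assume "shear zigzag.circle_map \<in> square_summable"
  then have "(\<lambda>e. (shear zigzag.circle_map e)\<^sup>2) summable_on farey_edges"
    by (simp add: square_summable_def)
  then have "(\<lambda>e. (shear zigzag.circle_map e)\<^sup>2) summable_on range ?e"
    by (rule summable_on_subset_banach) (use fan_edge_in_farey_edges in auto)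
  moreover have "inj ?e" by (rule injI) (drule injD[OF inj_fan_edge], simp)
  ultimately have "(\<lambda>m::nat. (ln (6 / 7 :: real))\<^sup>2) summable_on UNIV"
    by (subst (asm) summable_on_reindex) (auto simp only: o_def shear_zigzag)
  then have "summable (\<lambda>m::nat. (ln (6 / 7 :: real))\<^sup>2)"
    by (rule summable_on_imp_summable)
  then show False by (simp add: summable_const_iff)
qed

theorem proposition5p11:
  shows "(\<exists>s \<in> square_summable.
            \<not> (\<exists>h. normalized_circle_homeo h \<and> (\<forall>e \<in> farey_edges. shear h e = s e))) \<and>
         (\<exists>h. normalized_circle_homeo h \<and> quasisymmetric h \<and> shear h \<notin> square_summable)"
proof
  show "\<exists>s \<in> square_summable.
      \<not> (\<exists>h. normalized_circle_homeo h \<and> (\<forall>e \<in> farey_edges. shear h e = s e))"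
    by (rule bexI[OF _ blocking_shear_square_summable]) (metis blocking_shear_not_induced)
  show "\<exists>h. normalized_circle_homeo h \<and> quasisymmetric h \<and> shear h \<notin> square_summable"
    using normalized_zigzag zigzag.quasisymmetric_circle_map shear_zigzag_not_square_summable
    by (intro exI[of _ zigzag.circle_map] conjI)
qed

end
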